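(* Let $p>5$ be a prime such that $-1$ is a quadratic residue modulo $p$ and $2$ and $3$ are both quadratic non-residues modulo $p$. Then the path system $\mathcal{P}_p$ on the Paley graph $G_p$ is irreducible and non-metrizable.
   Context: For a prime $p$ with $-1$ a quadratic residue (i.e. $p\equiv 1\pmod 4$), let $R$ and $N$ denote the sets of nonzero quadratic residues and quadratic non-residues in $\mathbb{F}_p$. The Paley graph $G_p$ has vertex set $\mathbb{F}_p$, with $a,b$ adjacent iff $a-b\in R$ (this relation is symmetric since $-1\in R$). A path system $\mathcal{P}$ in a graph $G=(V,E)$ is a collection of simple paths in $G$ such that for every pair of distinct vertices $u,v$ there is exactly one path $P_{u,v}\in\mathcal{P}$ connecting $u$ and $v$. $\mathcal{P}$ is metrizable if there exists $w:E\to(0,\infty)$ such that for all $u,v$, $w(P_{u,v})\le w(Q)$ for every $u$–$v$ path $Q$ in $G$ (where $w$ of a path is the sum of its edge weights). A partition $V=A\sqcup B$ with $A,B\neq\emptyset$ is a reduction of $\mathcal{P}$ if for all $u,v\in A$ all vertices of $P_{u,v}$ lie in $A$, and for all $u,v\in B$ all vertices of $P_{u,v}$ lie in $B$; $\mathcal{P}$ is irreducible if it has no reduction. The path system $\mathcal{P}_p$ on $G_p$ (assuming $2,3\in N$) is defined for $a\neq b\in\mathbb{F}_p$ by: if $b-a\in R$, then $P_{a,b}=(a,b)$; if $b-a=3$, then $P_{a,b}=(a,a+1,a+2,b)$ (and $P_{b,a}$ is the same path); if $b-a\in N$ and $b-a\neq\pm3$, then $P_{a,b}=(a,\tfrac{a+b}{2},b)$.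 *)

theory Defs
  imports "HOL-Number_Theory.Number_Theory"
begin

definition is_path :: "('a \<Rightarrow> 'a \<Rightarrow> bool) \<Rightarrow> 'a set \<Rightarrow> 'a list \<Rightarrow> 'a \<Rightarrow> 'a \<Rightarrow> bool" where
  "is_path E V xs u v \<longleftrightarrow>
     xs \<noteq> [] \<and> hd xs = u \<and> last xs = v \<and> distinct xs \<and> set xs \<subseteq> V \<and>
     (\<forall>i. Suc i < length xs \<longrightarrow> E (xs ! i) (xs ! Suc i))"

definition path_system :: "('a \<Rightarrow> 'a \<Rightarrow> bool) \<Rightarrow> 'a set \<Rightarrow> ('a \<Rightarrow> 'a \<Rightarrow> 'a list) \<Rightarrow> bool" where
  "path_system E V P \<longleftrightarrow>
     (\<forall>u\<in>V. \<forall>v\<in>V. u \<noteq> v \<longrightarrow> is_path E V (P u v) u v \<and> P v u = rev (P u v))"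

definition path_weight :: "('a set \<Rightarrow> real) \<Rightarrow> 'a list \<Rightarrow> real" where
  "path_weight w xs = sum_list (map (\<lambda>(x, y). w {x, y}) (zip xs (tl xs)))"

definition metrizable :: "('a \<Rightarrow> 'a \<Rightarrow> bool) \<Rightarrow> 'a set \<Rightarrow> ('a \<Rightarrow> 'a \<Rightarrow> 'a list) \<Rightarrow> bool" where
  "metrizable E V P \<longleftrightarrow>
     (\<exists>w :: 'a set \<Rightarrow> real.
        (\<forall>a\<in>V. \<forall>b\<in>V. E a b \<longrightarrow> w {a, b} > 0) \<and>
        (\<forall>u\<in>V. \<forall>v\<in>V. u \<noteq> v \<longrightarrow>
           (\<forall>Q. is_path E V Q u v \<longrightarrow> path_weight w (P u v) \<le> path_weight w Q)))"

definition is_reduction :: "'a set \<Rightarrow> ('a \<Rightarrow> 'a \<Rightarrow> 'a list) \<Rightarrow> 'a set \<Rightarrow> bool" where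
  "is_reduction V P A \<longleftrightarrow>
     A \<subseteq> V \<and> A \<noteq> {} \<and> V - A \<noteq> {} \<and>
     (\<forall>u\<in>A. \<forall>v\<in>A. u \<noteq> v \<longrightarrow> set (P u v) \<subseteq> A) \<and>
     (\<forall>u\<in>V - A. \<forall>v\<in>V - A. u \<noteq> v \<longrightarrow> set (P u v) \<subseteq> V - A)"

definition irreducible_ps :: "'a set \<Rightarrow> ('a \<Rightarrow> 'a \<Rightarrow> 'a list) \<Rightarrow> bool" where
  "irreducible_ps V P \<longleftrightarrow> \<not> (\<exists>A. is_reduction V P A)"

(* Paley graph G_p: F_p represented by {0..<p} with arithmetic mod p *)
definition paley_V :: "int \<Rightarrow> int set" where
  "paley_V p = {0..<p}"

definition paley_adj :: "int \<Rightarrow> int \<Rightarrow> int \<Rightarrow> bool" where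
  "paley_adj p a b \<longleftrightarrow> (a - b) mod p \<noteq> 0 \<and> QuadRes p (a - b)"

(* (a+b)/2 in F_p: (p+1) div 2 is the inverse of 2 mod odd p *)
definition paley_mid :: "int \<Rightarrow> int \<Rightarrow> int \<Rightarrow> int" where
  "paley_mid p a b = ((a + b) * ((p + 1) div 2)) mod p"

definition paley_P :: "int \<Rightarrow> int \<Rightarrow> int \<Rightarrow> int list" where
  "paley_P p a b =
     (if QuadRes p (b - a) then [a, b]
      else if (b - a) mod p = 3 then [a, (a + 1) mod p, (a + 2) mod p, b]
      else if (a - b) mod p = 3 then [a, (b + 2) mod p, (b + 1) mod p, b]
      else [a, paley_mid p a b, b])"

end

theory Submission
  imports Defs
begin

text \<open>
  Non-metrizability. Summing a metrizing weight over all translates gives a positive even function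
  \<open>W\<close> on residues such that \<open>2 W(r) \<le> W(x) + W(y)\<close> whenever \<open>x + y = 2r\<close> and \<open>r \<noteq> \<plusminus>3/2\<close>, while the
  detour \<open>(a, a+4, a+3)\<close> gives \<open>2 W(1) \<le> W(4)\<close>. Let \<open>S\<close> be the set where \<open>W\<close> is maximal on the residues
  other than \<open>\<plusminus>3/2\<close>; then \<open>1 \<notin> S\<close>, and \<open>r \<in> S\<close> forces \<open>x, y \<in> S\<close> as soon as \<open>x + y = 2r\<close> and neither
  is \<open>\<plusminus>3/2\<close>. The splittings \<open>1/3 = 1 - 2/3\<close>, \<open>1/2 = 2/3 - 1/6\<close> and \<open>3/4 = 1 - 1/4\<close> show in turn that
  \<open>1/6\<close>, \<open>1/4\<close> and \<open>3/8\<close> are not in \<open>S\<close>, so \<open>2r = 6r - 4r\<close> makes \<open>S\<close> invariant under multiplication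
  by 4 and 6. Then it is invariant under every \<open>k\<close> with \<open>k\<close> and \<open>2 - k\<close> residues, since an obstruction
  \<open>rk = \<plusminus>3/2\<close> would put \<open>1/k\<close> into \<open>S\<close>, and \<open>2/k = 1 + (2 - k)/k\<close>. These \<open>k\<close> together with 4 generate all residues; hence \<open>S\<close> is empty, which is absurd.

  Irreducibility. In a reduction, pick \<open>b\<close> in one part with \<open>b + 1\<close> in the other. Paths with
  differences 2, 3 and 8 force \<open>b - 6, \<dots>, b\<close> into the first part and \<open>b + 1, \<dots>, b + 7\<close> into the
  second. Midpoints at distance \<open>r\<close>, where \<open>r\<close> is 6 or a perfect square between \<open>(m + 1)/2\<close> and \<open>m - 2\<close>, extend both
  intervals from length \<open>m\<close> to \<open>m + 1\<close>, until they overlap modulo \<open>p\<close>.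
\<close>

section \<open>Preliminaries on Legendre symbols, divisibility, paths and reductions\<close>

text \<open>Euler's criterion gives the identity modulo \<open>p\<close>. Both sides lie in {-1, 0,
  1}, so they differ by at most 2 < \<open>p\<close> and must agree.\<close>

lemma Legendre_mult:
  fixes p a b :: int
  assumes "prime p" and "2 < p"
  shows "Legendre (a * b) p = Legendre a p * Legendre b p"
proof -
  define q where "q = nat p"
  have q: "prime q" "2 < q" "int q = p"
    using assms prime_int_nat_transfer[of p] unfolding q_def by linarith+
  note euler = euler_criterion[OF q(1,2), unfolded q(3)]
  have "[Legendre a p * Legendre b p = Legendre (a * b) p] (mod p)"
    using cong_mult[OF euler[of a] euler[of b]] euler[of "a * b"]
    by (metis cong_sym cong_trans power_mult_distrib)
  then have "p dvd Legendre a p * Legendre b p - Legendre (a * b) p"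
    by (simp add: cong_iff_dvd_diff)
  moreover have "Legendre x p \<in> {-1, 0, 1}" for x
    by (simp add: Legendre_def)
  from this[of a] this[of b] this[of "a * b"]
  have "\<bar>Legendre a p * Legendre b p - Legendre (a * b) p\<bar> < p"
    using assms(2) by auto
  ultimately show ?thesis
    using zdvd_not_zless[of "\<bar>Legendre a p * Legendre b p - Legendre (a * b) p\<bar>" p] by force
qed

text \<open>This rule and the next serve as certificates: once the coefficients are supplied, a
  divisibility claim reduces to a ring identity.\<close>

lemma dvd_lin1: "c = s * a \<Longrightarrow> p dvd a \<Longrightarrow> p dvd c"
  for p :: "'a::comm_ring_1"
  by simp

lemma dvd_lin2: "c = s * a + t * b \<Longrightarrow> p dvd a \<Longrightarrow> p dvd b \<Longrightarrow> p dvd c"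
  for p :: "'a::comm_ring_1"
  by simp

lemma is_path_single [simp]: "is_path E V [x] u v \<longleftrightarrow> x = u \<and> x = v \<and> x \<in> V"
  by (auto simp: is_path_def)

lemma is_path_Cons [simp]:
  "is_path E V (x # y # zs) u v \<longleftrightarrow>
     x = u \<and> x \<in> V \<and> x \<notin> set (y # zs) \<and> E x y \<and> is_path E V (y # zs) y v"
proof -
  have "(\<forall>i. Suc i < length (x # y # zs) \<longrightarrow> E ((x # y # zs) ! i) ((x # y # zs) ! Suc i)) \<longleftrightarrow>
      E x y \<and> (\<forall>i. Suc i < length (y # zs) \<longrightarrow> E ((y # zs) ! i) ((y # zs) ! Suc i))"
    (is "(\<forall>i. ?Q i) \<longleftrightarrow> _")
  proof -
    have "(\<forall>i. ?Q i) \<longleftrightarrow> ?Q 0 \<and> (\<forall>i. ?Q (Suc i))"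
      by (metis not0_implies_Suc)
    then show ?thesis by simp
  qed
  then show ?thesis
    unfolding is_path_def by auto
qed

lemma path_weight_Cons:
  "path_weight w (x # y # zs) = w {x, y} + path_weight w (y # zs)"
  "path_weight w [x] = 0"
  by (simp_all add: path_weight_def)

text \<open>Stating membership as an equivalence treats the two parts of a reduction at
  once.\<close>

lemma reduction_path:
  assumes "is_reduction V P A" and "u \<in> V" and "v \<in> V" and "u \<noteq> v"
    and "u \<in> A \<longleftrightarrow> v \<in> A" and "x \<in> set (P u v)"
  shows "x \<in> A \<longleftrightarrow> u \<in> A"
  using assms unfolding is_reduction_def by blast

lemma exists_square_between:
  fixes m :: int
  assumes "11 \<le> m"
  obtains k where "3 \<le> k" and "k * k \<le> m - 2" and "m + 1 \<le> 2 * (k * k)"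
proof -
  have "\<exists>k\<ge>3. k * k \<le> m - 2 \<and> m - 2 < (k + 1) * (k + 1)"
    using assms
  proof (induction m rule: int_ge_induct)
    case base
    show ?case by (rule exI[of _ 3]) simp
  next
    case (step m)
    then obtain k where k: "3 \<le> k" "k * k \<le> m - 2" "m - 2 < (k + 1) * (k + 1)"
      by blast
    show ?case
    proof (cases "m - 1 < (k + 1) * (k + 1)")
      case True
      then show ?thesis using k by (intro exI[of _ k]) simp
    next
      case False
      then show ?thesis using k by (intro exI[of _ "k + 1"]) (simp add: algebra_simps)
    qed
  qed
  then obtain k where k: "3 \<le> k" "k * k \<le> m - 2" "m - 2 < (k + 1) * (k + 1)"
    by blast
  \<comment> \<open>The product equals \<open>2 * (k * k) - (k + 1) * (k + 1) - 2\<close>, so the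
    maximality of \<open>k\<close> yields the lower bound on the square.\<close>
  have "0 \<le> (k - 3) * (k + 1)"
    using k(1) by simp
  then have "m + 1 \<le> 2 * (k * k)"
    using k(3) by (simp add: algebra_simps)
  then show thesis using that k by blast
qed

section \<open>Quadratic residues and the paths of the system\<close>

locale paley_prime =
  fixes p :: int
  assumes prime_p: "prime p"
    and p_gt_5: "p > 5"
    and minus_one: "QuadRes p (-1)"
    and two: "\<not> QuadRes p 2"
    and three: "\<not> QuadRes p 3"
begin

definition res :: "int \<Rightarrow> bool"
  where "res x \<longleftrightarrow> \<not> p dvd x \<and> QuadRes p x"

lemma QuadRes_cong: "QuadRes p a \<longleftrightarrow> QuadRes p b" if "p dvd a - b"
  using that unfolding QuadRes_def by (metis cong_iff_dvd_diff cong_sym cong_trans)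

lemma res_cong: "res a \<longleftrightarrow> res b" if "p dvd a - b"
  using QuadRes_cong[OF that] that unfolding res_def
  by (metis diff_add_cancel dvd_add_right_iff)

lemma not_dvd_res: "res x \<Longrightarrow> \<not> p dvd x"
  by (simp add: res_def)

lemma dvd_mult_iff: "p dvd a * b \<longleftrightarrow> p dvd a \<or> p dvd b"
  using prime_p by (rule prime_dvd_mult_iff)

lemma res_mult_iff:
  assumes "\<not> p dvd a" and "\<not> p dvd b"
  shows "res (a * b) \<longleftrightarrow> (res a \<longleftrightarrow> res b)"
proof -
  have "2 < p" using p_gt_5 by simp
  from Legendre_mult[OF prime_p this, of a b] assms
  show ?thesis
    by (auto simp: Legendre_def res_def cong_0_iff dvd_mult_iff split: if_splits)
qed

lemma res_mult: "res a \<Longrightarrow> res b \<Longrightarrow> res (a * b)"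
  using res_mult_iff not_dvd_res by blast

lemma res_square: "\<not> p dvd a \<Longrightarrow> res (a * a)"
  by (simp add: res_mult_iff)

lemma not_dvd_small: "0 < a \<Longrightarrow> a < p \<Longrightarrow> \<not> p dvd a"
  by (simp add: zdvd_not_zless)

lemma odd_p: "odd p"
  using prime_p p_gt_5 prime_odd_int by auto

text \<open>Modulo 7, 2 is the square of 3; modulo 11 and 13, 3 is the square of 5 and of 4. The
  assumptions on 2 and 3 thus exclude these primes.\<close>

lemma not_dvd_7: "\<not> p dvd 7" and not_dvd_11: "\<not> p dvd 11" and not_dvd_13: "\<not> p dvd 13"
proof -
  have eq: "p = q" if "p dvd q" "prime q" for q
    using that prime_p by (simp add: primes_dvd_imp_eq)
  have pr: "prime (7::int)" "prime (11::int)" "prime (13::int)"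
    by simp_all
  have "QuadRes 7 2"
    unfolding QuadRes_def by (rule exI[of _ 3]) (simp add: cong_def)
  then show "\<not> p dvd 7" using eq pr two by blast
  have "QuadRes 11 3"
    unfolding QuadRes_def by (rule exI[of _ 5]) (simp add: cong_def)
  then show "\<not> p dvd 11" using eq pr three by blast
  have "QuadRes 13 3"
    unfolding QuadRes_def by (rule exI[of _ 4]) (simp add: cong_def)
  then show "\<not> p dvd 13" using eq pr three by blast
qed

lemma not_dvd_1: "\<not> p dvd 1" and not_dvd_2: "\<not> p dvd 2" and not_dvd_3: "\<not> p dvd 3"
  and not_dvd_5: "\<not> p dvd 5"
  using p_gt_5 by (simp_all add: not_dvd_small)

lemma res_1: "res 1"
  using res_square[of 1] not_dvd_1 by simp

lemma res_minus_iff [simp]: "res (- a) \<longleftrightarrow> res a"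
proof (cases "p dvd a")
  case False
  moreover have "\<not> p dvd -1" "res (-1)"
    using not_dvd_1 minus_one by (simp_all add: res_def)
  ultimately show ?thesis
    using res_mult_iff[of "-1" a] by simp
qed (simp add: res_def)

lemma QuadRes_minus_iff: "QuadRes p (- a) \<longleftrightarrow> QuadRes p a" if "\<not> p dvd a"
  using res_minus_iff[of a] that by (simp add: res_def)

lemma not_res_2: "\<not> res 2" and not_res_3: "\<not> res 3"
  using two three by (auto simp: res_def)

lemma res_4: "res 4" and res_6: "res 6" and res_9: "res 9"
  using res_square[of 2] res_mult_iff[of 2 3] res_square[of 3]
    not_dvd_2 not_dvd_3 not_res_2 not_res_3 by auto

lemma res_double_iff: "res (2 * a) \<longleftrightarrow> \<not> res a" if "\<not> p dvd a"
  using res_mult_iff[of 2 a] that not_dvd_2 not_res_2 by simp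

lemma dvd_mod_diff: "p dvd x mod p - x"
  by (simp add: mod_eq_dvd_iff[symmetric])

lemma mod_in_V: "x mod p \<in> paley_V p"
  using p_gt_5 by (simp add: paley_V_def)

lemma mod_V: "a \<in> paley_V p \<Longrightarrow> a mod p = a"
  by (simp add: paley_V_def)

lemma adj_iff: "paley_adj p a b \<longleftrightarrow> res (a - b)"
  by (auto simp: paley_adj_def res_def dvd_eq_mod_eq_0)

lemma adj_mod: "paley_adj p (a mod p) (b mod p) \<longleftrightarrow> res (b - a)"
proof -
  have "p dvd (a mod p - b mod p) - (a - b)"
    by (rule dvd_lin2[where s = 1 and t = "-1", OF _ dvd_mod_diff[of a] dvd_mod_diff[of b]]) simp
  then show ?thesis
    using res_cong res_minus_iff[of "a - b"] by (simp add: adj_iff)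
qed

definition half :: int
  where "half = (p + 1) div 2"

lemma twice_half: "p dvd 2 * half - 1"
proof -
  have "2 * half - 1 = p"
    unfolding half_def using odd_p by presburger
  then show ?thesis by simp
qed

text \<open>Pairs are parametrised by half their difference: as 2 is a non-residue,
  \<open>2 * r\<close> is a non-residue exactly when \<open>r\<close> is a residue. The last two
  assumptions keep the difference away from 3 and -3.\<close>

lemma paley_P_mid:
  assumes "a \<in> paley_V p" and "res r" and "\<not> p dvd 2 * r - 3" and "\<not> p dvd 2 * r + 3"
  shows "paley_P p a ((a + 2 * r) mod p) = [a, (a + r) mod p, (a + 2 * r) mod p]"
proof -
  define b where "b = (a + 2 * r) mod p"
  have b: "p dvd b - (a + 2 * r)"
    unfolding b_def by (rule dvd_mod_diff)
  have r: "\<not> p dvd r"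
    using assms(2) not_dvd_res by blast
  have "\<not> res (2 * r)" "\<not> p dvd 2 * r"
    using res_double_iff[OF r] assms(2) r not_dvd_2 by (simp_all add: dvd_mult_iff)
  moreover have "p dvd (b - a) - 2 * r"
    using b by (simp add: algebra_simps)
  ultimately have nq: "\<not> QuadRes p (b - a)"
    using QuadRes_cong by (auto simp: res_def)
  have "(b - a) mod p \<noteq> 3"
  proof
    assume "(b - a) mod p = 3"
    then have "p dvd 3 - (b - a)"
      using dvd_mod_diff[of "b - a"] by simp
    with b have "p dvd 2 * r - 3"
      by (rule dvd_lin2[where s = "-1" and t = "-1", rotated]) simp
    with assms show False by simp
  qed
  moreover have "(a - b) mod p \<noteq> 3"
  proof
    assume "(a - b) mod p = 3"
    then have "p dvd 3 - (a - b)"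
      using dvd_mod_diff[of "a - b"] by simp
    with b have "p dvd 2 * r + 3"
      by (rule dvd_lin2[where s = "-1" and t = 1, rotated]) simp
    with assms show False by simp
  qed
  moreover have "paley_mid p a b = (a + r) mod p"
  proof -
    have "p dvd (a + b) * half - (a + r)"
      by (rule dvd_lin2[where s = half and t = "a + r", OF _ b twice_half])
        (simp add: algebra_simps)
    then show ?thesis
      by (simp add: paley_mid_def half_def mod_eq_dvd_iff)
  qed
  ultimately show ?thesis
    using nq by (simp add: paley_P_def b_def)
qed

lemma mod_diff_eq_3: "(((a + 3) mod p) - a) mod p = 3"
  using p_gt_5 by (simp add: mod_diff_left_eq)

lemma paley_P_three:
  assumes "a \<in> paley_V p"
  shows "paley_P p a ((a + 3) mod p) = [a, (a + 1) mod p, (a + 2) mod p, (a + 3) mod p]"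
    and "paley_P p ((a + 3) mod p) a = [(a + 3) mod p, (a + 2) mod p, (a + 1) mod p, a]"
proof -
  define b where "b = (a + 3) mod p"
  have b: "p dvd b - (a + 3)"
    unfolding b_def by (rule dvd_mod_diff)
  have "p dvd (b - a) - 3"
    using b by (simp add: algebra_simps)
  moreover have "p dvd (a - b) - (-3)"
    using b by (rule dvd_lin1[where s = "-1", rotated]) simp
  moreover have "\<not> QuadRes p (-3)"
    using QuadRes_minus_iff[OF not_dvd_3] three by simp
  ultimately have nq: "\<not> QuadRes p (b - a)" "\<not> QuadRes p (a - b)"
    using QuadRes_cong three by blast+
  have *: "(b - a) mod p = 3"
    unfolding b_def by (rule mod_diff_eq_3)
  have "(a - b) mod p \<noteq> 3"
  proof
    assume "(a - b) mod p = 3"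
    then have "p dvd 3 - (a - b)"
      using dvd_mod_diff[of "a - b"] by simp
    with b have "p dvd 2 * 3"
      by (rule dvd_lin2[where s = "-1" and t = 1, rotated]) simp
    then show False using not_dvd_2 not_dvd_3 dvd_mult_iff by blast
  qed
  with nq * show "paley_P p a ((a + 3) mod p) = [a, (a + 1) mod p, (a + 2) mod p, (a + 3) mod p]"
    and "paley_P p ((a + 3) mod p) a = [(a + 3) mod p, (a + 2) mod p, (a + 1) mod p, a]"
    by (simp_all add: paley_P_def b_def)
qed

lemma paley_pair_cases [consumes 3, case_names adjacent three minus_three mid]:
  assumes "u \<in> paley_V p" and "v \<in> paley_V p" and "u \<noteq> v"
  obtains "res (v - u)" | "v = (u + 3) mod p" | "u = (v + 3) mod p"
  | r where "res r" "\<not> p dvd 2 * r - 3" "\<not> p dvd 2 * r + 3" "v = (u + 2 * r) mod p"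
proof -
  \<comment> \<open>This is half the difference of \<open>u\<close> and \<open>v\<close> in the
    field.\<close>
  define r where "r = (v - u) * half"
  have eq: "x = y mod p" if "x \<in> paley_V p" "p dvd x - y" for x y
    using that mod_V by (metis mod_eq_dvd_iff)
  have r: "p dvd 2 * r - (v - u)"
    unfolding r_def by (rule dvd_lin1[where s = "v - u", OF _ twice_half])
      (simp add: algebra_simps)
  have "\<not> p dvd v - u"
    using assms mod_V by (metis mod_eq_dvd_iff)
  moreover have "p dvd v - u" if "p dvd r"
    using r that by (rule dvd_lin2[where s = "-1" and t = 2, rotated]) simp
  ultimately have "\<not> p dvd r"
    by blast
  show thesis
  proof (cases "res (v - u) \<or> v = (u + 3) mod p \<or> u = (v + 3) mod p")
    case False
    have "\<not> res (2 * r)"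
      using False res_cong[OF r] by simp
    then have "res r"
      using res_double_iff \<open>\<not> p dvd r\<close> by blast
    moreover have "\<not> p dvd 2 * r - 3"
    proof
      assume "p dvd 2 * r - 3"
      with r have "p dvd v - (u + 3)"
        by (rule dvd_lin2[where s = "-1" and t = 1, rotated]) simp
      then show False using eq assms False by blast
    qed
    moreover have "\<not> p dvd 2 * r + 3"
    proof
      assume "p dvd 2 * r + 3"
      with r have "p dvd u - (v + 3)"
        by (rule dvd_lin2[where s = 1 and t = "-1", rotated]) simp
      then show False using eq assms False by blast
    qed
    moreover have "v = (u + 2 * r) mod p"
    proof (rule eq)
      show "p dvd v - (u + 2 * r)" using r by (rule dvd_lin1[where s = "-1", rotated]) simp
    qed (rule assms)
    ultimately show thesis using that by blast
  qed (use that in blast)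
qed

lemma mod_neq: "\<not> p dvd b - a \<Longrightarrow> a mod p \<noteq> b mod p"
  by (metis mod_eq_dvd_iff)

text \<open>Residues are nonzero, so neighbouring vertices differ; the condition on
  \<open>x + y\<close> separates the two ends.\<close>

lemma is_path_mod2:
  assumes "a \<in> paley_V p" and "res x" and "res y" and "\<not> p dvd x + y"
  shows "is_path (paley_adj p) (paley_V p) [a, (a + x) mod p, (a + (x + y)) mod p]
           a ((a + (x + y)) mod p)"
  using assms not_dvd_res[OF assms(2)] not_dvd_res[OF assms(3)]
    adj_mod[of a "a + x"] adj_mod[of "a + x" "a + (x + y)"]
    mod_neq[of "a + x" a] mod_neq[of "a + (x + y)" a] mod_neq[of "a + (x + y)" "a + x"]
  by (simp add: mod_in_V mod_V)

lemma is_path_mod3: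
  assumes "a \<in> paley_V p" and "res x" and "res y" and "res z"
    and "\<not> p dvd x + y" and "\<not> p dvd y + z" and "\<not> p dvd x + y + z"
  shows "is_path (paley_adj p) (paley_V p)
           [a, (a + x) mod p, (a + (x + y)) mod p, (a + (x + y + z)) mod p]
           a ((a + (x + y + z)) mod p)"
  using assms not_dvd_res[OF assms(2)] not_dvd_res[OF assms(3)] not_dvd_res[OF assms(4)]
    adj_mod[of a "a + x"] adj_mod[of "a + x" "a + (x + y)"]
    adj_mod[of "a + (x + y)" "a + (x + y + z)"]
    mod_neq[of "a + x" a] mod_neq[of "a + (x + y)" a] mod_neq[of "a + (x + y)" "a + x"]
    mod_neq[of "a + (x + y + z)" a] mod_neq[of "a + (x + y + z)" "a + x"]
    mod_neq[of "a + (x + y + z)" "a + (x + y)"]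
  by (simp add: mod_in_V mod_V)

lemma paley_path_system: "path_system (paley_adj p) (paley_V p) (paley_P p)"
  unfolding path_system_def
proof (intro ballI impI)
  fix u v assume uv: "u \<in> paley_V p" "v \<in> paley_V p" "u \<noteq> v"
  let ?path = "is_path (paley_adj p) (paley_V p)"
  from uv show "?path (paley_P p u v) u v \<and> paley_P p v u = rev (paley_P p u v)"
  proof (cases rule: paley_pair_cases)
    case adjacent
    then have "res (u - v)" "QuadRes p (v - u)" "QuadRes p (u - v)"
      using res_minus_iff[of "v - u"] by (simp_all add: res_def)
    then show ?thesis
      using uv by (simp add: paley_P_def adj_iff)
  next
    case three
    have "?path [u, (u + 1) mod p, (u + 2) mod p, (u + 3) mod p] u ((u + 3) mod p)"
      using is_path_mod3[OF uv(1) res_1 res_1 res_1] not_dvd_2 not_dvd_3 by simp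
    then show ?thesis
      unfolding three paley_P_three[OF uv(1)] by simp
  next
    case minus_three
    have "?path [(v + 3) mod p, (v + 2) mod p, (v + 1) mod p, v] ((v + 3) mod p) v"
      \<comment> \<open>The backward path starts at \<open>v + 3\<close> and takes three steps of
        -1.\<close>
      using is_path_mod3[of "(v + 3) mod p" "-1" "-1" "-1"] res_1 not_dvd_2 not_dvd_3 uv(2)
      by (simp add: mod_in_V mod_diff_left_eq mod_V add.commute
          del: is_path_Cons)
    then show ?thesis
      unfolding minus_three paley_P_three[OF uv(2)] by simp
  next
    case (mid r)
    have "\<not> p dvd 2 * r"
      using not_dvd_res[OF mid(1)] not_dvd_2 by (simp add: dvd_mult_iff)
    then have "?path [u, (u + r) mod p, (u + 2 * r) mod p] u ((u + 2 * r) mod p)"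
      using is_path_mod2[OF uv(1) mid(1) mid(1), folded mult_2] by blast
    moreover have "paley_P p v u = [v, (u + r) mod p, u]"
    proof -
      have "\<not> p dvd 2 * - r - 3" "\<not> p dvd 2 * - r + 3"
        using mid(2,3) dvd_minus_iff[of p "2 * - r - 3"] dvd_minus_iff[of p "2 * - r + 3"]
        by (simp_all add: add.commute)
      then have "paley_P p v ((v + 2 * - r) mod p) = [v, (v + - r) mod p, (v + 2 * - r) mod p]"
        using paley_P_mid[of v "- r"] uv(2) mid(1) by simp
      moreover have "(v + 2 * - r) mod p = u" "(v + - r) mod p = (u + r) mod p"
        unfolding mid(4) mod_add_left_eq using mod_V[OF uv(1)] by (simp_all add: add.commute)
      ultimately show ?thesis by simp
    qed
    ultimately show ?thesis
      unfolding mid(4) paley_P_mid[OF uv(1) mid(1-3)] by simp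
  qed
qed

section \<open>Irreducibility\<close>

text \<open>The differences \<open>r = \<plusminus>3/2\<close>, for which the midpoint is not on the path between
  \<open>a\<close> and \<open>a + 2r\<close>.\<close>

definition special :: "int \<Rightarrow> bool"
  where "special r \<longleftrightarrow> p dvd 2 * r - 3 \<or> p dvd 2 * r + 3"

lemma special_minus [simp]: "special (- r) \<longleftrightarrow> special r"
  using dvd_minus_iff[of p "2 * - r - 3"] dvd_minus_iff[of p "2 * - r + 3"]
  by (auto simp: special_def add.commute)

lemma special_cong: "special r \<longleftrightarrow> special s" if "p dvd r - s"
proof -
  have "special s" if "special r" "p dvd r - s" for r s
    using that unfolding special_def
    by (elim disjE; intro dvd_lin2[where s = 1 and t = "-2" and b = "r - s", THEN disjI1]
          dvd_lin2[where s = 1 and t = "-2" and b = "r - s", THEN disjI2]; simp)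
  then show ?thesis
    using \<open>p dvd r - s\<close> dvd_diff_commute by blast
qed

lemma not_special_1: "\<not> special 1"
  using not_dvd_1 not_dvd_5 by (simp add: special_def)

lemma not_special_4: "\<not> special 4"
  using not_dvd_5 not_dvd_11 by (simp add: special_def)

lemma not_special_9: "\<not> special 9"
  using not_dvd_3 not_dvd_5 not_dvd_7 dvd_mult_iff[of 3 5] dvd_mult_iff[of 3 7]
  by (simp add: special_def)

lemma reduction_mid:
  assumes "is_reduction (paley_V p) (paley_P p) A"
    and "res r" and "\<not> special r"
    and "a mod p \<in> A \<longleftrightarrow> (a + 2 * r) mod p \<in> A"
  shows "(a + r) mod p \<in> A \<longleftrightarrow> a mod p \<in> A"
proof -
  let ?u = "a mod p" and ?v = "(a + 2 * r) mod p"
  have "\<not> p dvd 2 * r"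
    using not_dvd_res[OF assms(2)] not_dvd_2 dvd_mult_iff by blast
  then have "?u \<noteq> ?v"
    using mod_neq[of "a + 2 * r" a] by simp
  moreover have "set (paley_P p ?u ?v) = {?u, (a + r) mod p, ?v}"
    using paley_P_mid[OF mod_in_V[of a] assms(2)] assms(3)
    by (simp add: special_def mod_add_left_eq)
  ultimately show ?thesis
    using reduction_path[OF assms(1) mod_in_V mod_in_V] assms(4) by blast
qed

lemma reduction_three:
  assumes "is_reduction (paley_V p) (paley_P p) A"
    and "a mod p \<in> A \<longleftrightarrow> (a + 3) mod p \<in> A"
  shows "(a + 1) mod p \<in> A \<longleftrightarrow> a mod p \<in> A"
    and "(a + 2) mod p \<in> A \<longleftrightarrow> a mod p \<in> A"
proof -
  let ?u = "a mod p" and ?v = "(a + 3) mod p"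
  have "?u \<noteq> ?v"
    using mod_neq[of "a + 3" a] not_dvd_3 by simp
  moreover have "set (paley_P p ?u ?v) = {?u, (a + 1) mod p, (a + 2) mod p, ?v}"
    using paley_P_three(1)[OF mod_in_V[of a]] by (simp add: mod_add_left_eq)
  ultimately show "(a + 1) mod p \<in> A \<longleftrightarrow> a mod p \<in> A" "(a + 2) mod p \<in> A \<longleftrightarrow> a mod p \<in> A"
    using reduction_path[OF assms(1) mod_in_V mod_in_V] assms(2) by blast+
qed

text \<open>The choice is 4 for \<open>m = 7\<close>, 6 for \<open>m\<close> from 8 to 10, and a
  perfect square from 11 on.\<close>

lemma exists_res_between:
  assumes "7 \<le> m" and "2 * m < p"
  obtains r where "res r" "\<not> special r" "m + 1 \<le> 2 * r" "r \<le> m - 2"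
proof -
  have "\<exists>r. res r \<and> 4 \<le> r \<and> m + 1 \<le> 2 * r \<and> r \<le> m - 2"
  proof (cases "m \<le> 10")
    case True
    then show ?thesis
      using assms(1) res_4 res_6 by (cases "m = 7") (auto intro: exI[of _ 4] exI[of _ 6])
  next
    case False
    then obtain k where k: "3 \<le> k" "k * k \<le> m - 2" "m + 1 \<le> 2 * (k * k)"
      using exists_square_between[of m] by auto
    have "k * 1 \<le> k * k" "3 * 3 \<le> k * k"
      using k(1) by (intro mult_mono; simp)+
    then have "k < p" "4 \<le> k * k"
      using k(2) assms by linarith+
    moreover have "res (k * k)"
      using \<open>k < p\<close> k(1) by (intro res_square not_dvd_small) auto
    ultimately show ?thesis using k by blast
  qed
  then obtain r where r: "res r" "4 \<le> r" "m + 1 \<le> 2 * r" "r \<le> m - 2"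
    by blast
  \<comment> \<open>Both \<open>2 * r - 3\<close> and \<open>2 * r + 3\<close> lie strictly between
    0 and \<open>p\<close>.\<close>
  moreover have "\<not> special r"
    unfolding special_def using r assms(2) by (simp add: not_dvd_small)
  ultimately show thesis using that by blast
qed

lemma p_ge_13: "p \<ge> 13"
proof (rule ccontr)
  assume "\<not> p \<ge> 13"
  then have "p \<in> {6..12}"
    using p_gt_5 by simp
  then have "p = 7 \<or> p = 9 \<or> p = 11"
    using odd_p by (auto simp: atLeastAtMost_iff) presburger
  then show False
    using not_dvd_7 not_dvd_11 not_dvd_res[OF res_9] by auto
qed

lemma paley_irreducible: "irreducible_ps (paley_V p) (paley_P p)"
  unfolding irreducible_ps_def
proof
  assume "\<exists>A. is_reduction (paley_V p) (paley_P p) A"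
  then obtain A where A: "is_reduction (paley_V p) (paley_P p) A" ..
  \<comment> \<open>Otherwise \<open>A\<close> is closed under adding 1, and walking around the
    cycle from a point of \<open>A\<close> reaches every vertex.\<close>
  have "\<exists>b. b mod p \<in> A \<and> (b + 1) mod p \<notin> A"
  proof (rule ccontr)
    assume "\<not> ?thesis"
    then have step: "b mod p \<in> A \<Longrightarrow> (b + 1) mod p \<in> A" for b
      by blast
    obtain u v where uv: "u \<in> A" "u \<in> paley_V p" "v \<in> paley_V p" "v \<notin> A"
      using A unfolding is_reduction_def by blast
    have "(u + int n) mod p \<in> A" for n
    proof (induction n)
      case 0
      then show ?case using uv mod_V by simp
    next
      case (Suc n)
      then show ?case using step[of "u + int n"] by (simp add: algebra_simps)
    qed
    from this[of "nat ((v - u) mod p)"] have "v mod p \<in> A"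
      using p_gt_5 by (simp add: mod_add_right_eq)
    then show False using uv mod_V by simp
  qed
  then obtain b where b: "b mod p \<in> A" "(b + 1) mod p \<notin> A"
    by blast
  define X where "X n \<longleftrightarrow> (b + n) mod p \<in> A" for n
  have mid: "X (n + r) \<longleftrightarrow> X n" if "res r" "\<not> special r" "X n \<longleftrightarrow> X (n + 2 * r)" for n r
    using reduction_mid[OF A that(1,2), of "b + n"] that(3) by (simp add: X_def add.assoc)
  have three: "X (n + 1) \<longleftrightarrow> X n" "X (n + 2) \<longleftrightarrow> X n" if "X n \<longleftrightarrow> X (n + 3)" for n
    using reduction_three[OF A, of "b + n"] that by (simp_all add: X_def add.assoc)
  note mid1 = mid[OF res_1 not_special_1] and mid4 = mid[OF res_4 not_special_4]
  have X: "X 0" "\<not> X 1"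
    using b by (simp_all add: X_def)
  \<comment> \<open>The path facts are used contrapositively: if an interior vertex and one end of
    its path lie in different parts, then so do the two ends.\<close>
  have X1: "X (-1)" "\<not> X 2"
    using mid1[of "-1"] mid1[of 0] X by auto
  have X2: "X (-2)" "\<not> X 3"
    using three[of "-2"] three[of 0] X X1 by auto
  have X4: "\<not> X 7" "\<not> X 6" "X (-5)" "X (-6)"
    using mid4[of "-1"] mid4[of "-2"] mid4[of "-5"] mid4[of "-6"] X1 X2 by auto
  \<comment> \<open>Here the path facts apply directly: the ends 3, 6 lie in one part, the ends -5,
    -2 in the other.\<close>
  have X3: "\<not> X 4" "\<not> X 5" "X (-4)" "X (-3)"
    using three[of 3] three[of "-5"] X2 X4 by auto
  have split: "(\<forall>n. 1 \<le> n \<and> n \<le> m \<longrightarrow> \<not> X n) \<and> (\<forall>n. 1 - m \<le> n \<and> n \<le> 0 \<longrightarrow> X n)"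
    if "7 \<le> m" "2 * m \<le> p + 1" for m
    using that
  proof (induction m rule: int_ge_induct)
    case base
    have "n \<in> {1, 2, 3, 4, 5, 6, 7}" if "1 \<le> n" "n \<le> 7" for n :: int
      using that by auto
    moreover have "n \<in> {-6, -5, -4, -3, -2, -1, 0}" if "-6 \<le> n" "n \<le> 0" for n :: int
      using that by auto
    ultimately show ?case
      using X X1 X2 X3 X4 by fastforce
  next
    case (step m)
    then have neg: "\<not> X n" if "1 \<le> n" "n \<le> m" for n
      using that by auto
    from step have pos: "X n" if "1 - m \<le> n" "n \<le> 0" for n
      using that by auto
    obtain r where r: "res r" "\<not> special r" "m + 1 \<le> 2 * r" "r \<le> m - 2"
      using exists_res_between[of m] step by auto
    \<comment> \<open>The path from \<open>m + 1 - 2 * r\<close> to \<open>m + 1\<close> starts in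
      the lower interval and has its midpoint in the upper one. The bounds on \<open>r\<close>
      ensure both, and also cover the mirrored path from \<open>- m\<close>.\<close>
    have "\<not> X (m + 1)"
      using mid[OF r(1,2), of "m + 1 - 2 * r"] pos[of "m + 1 - 2 * r"] neg[of "m + 1 - r"] r step
      by (auto simp: algebra_simps)
    moreover have "X (- m)"
      using mid[OF r(1,2), of "- m"] pos[of "r - m"] neg[of "2 * r - m"] r step
      by (auto simp: algebra_simps)
    moreover have "n \<le> m \<or> n = m + 1" if "n \<le> m + 1" for n
      using that by auto
    moreover have "1 - m \<le> n \<or> n = - m" if "1 - (m + 1) \<le> n" for n
      using that by auto
    ultimately show ?case
      using neg pos by blast
  qed
  \<comment> \<open>At this length \<open>m\<close> and \<open>1 - m\<close> differ by
    \<open>p\<close>, so one vertex would lie in both parts.\<close>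
  obtain m where m: "p + 1 = 2 * m"
    using odd_p by (metis evenE odd_one odd_even_add)
  then have "7 \<le> m"
    using p_ge_13 by simp
  then have "\<not> X m" "X (1 - m)"
    using split[of m] m by auto
  moreover have "(b + m) mod p = (b + (1 - m)) mod p"
    using m by (simp add: mod_eq_dvd_iff) (metis add_diff_cancel_right' dvd_refl mult_2)
  ultimately show False
    by (simp add: X_def)
qed

section \<open>Non-metrizability\<close>

lemma inverse_exists:
  assumes "\<not> p dvd a"
  obtains b where "p dvd a * b - 1"
proof -
  have "coprime a p"
    using assms prime_p prime_imp_coprime coprime_commute by blast
  then show thesis
    using cong_solve_coprime_int that by (metis cong_iff_dvd_diff)
qed

lemma res_mult_cancel: "res a \<Longrightarrow> res (a * b) \<Longrightarrow> res b"
  using res_mult_iff not_dvd_res dvd_mult by blast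

lemma res_3_mult_cancel: "\<not> res (3 * b) \<Longrightarrow> \<not> p dvd b \<Longrightarrow> res b"
  using res_mult_iff[of 3 b] not_dvd_3 not_res_3 by blast

text \<open>Here \<open>y\<close> stands for the fraction \<open>b / a\<close>; it equals 3/2 or
  -3/2 only if \<open>2 * b\<close> is \<open>3 * a\<close> or its negative.\<close>

lemma not_special_if:
  assumes "p dvd a * y - b" and "\<not> p dvd 2 * b - 3 * a" and "\<not> p dvd 2 * b + 3 * a"
  shows "\<not> special y"
proof
  assume "special y"
  then consider "p dvd 2 * y - 3" | "p dvd 2 * y + 3"
    by (auto simp: special_def)
  then show False
  proof cases
    case 1
    with assms(1) have "p dvd 2 * b - 3 * a"
      by (rule dvd_lin2[where s = "-2" and t = a, rotated]) (simp add: algebra_simps)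
    with assms show False by blast
  next
    case 2
    with assms(1) have "p dvd 2 * b + 3 * a"
      by (rule dvd_lin2[where s = "-2" and t = a, rotated]) (simp add: algebra_simps)
    with assms show False by blast
  qed
qed

section \<open>Emptiness of a set of residues closed under splitting\<close>

context
  fixes S :: "int \<Rightarrow> bool"
  assumes S_cong: "\<And>r s. p dvd r - s \<Longrightarrow> S r \<Longrightarrow> S s"
    and S_res: "\<And>r. S r \<Longrightarrow> res r"
    and S_minus: "\<And>r. S r \<Longrightarrow> S (- r)"
    and S_split: "\<And>r x y. S r \<Longrightarrow> res x \<Longrightarrow> res y \<Longrightarrow> \<not> special x \<Longrightarrow> \<not> special y \<Longrightarrow>
      p dvd x + y - 2 * r \<Longrightarrow> S x"
    and not_S_1: "\<not> S 1"
begin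

text \<open>Multiplication by \<open>k\<close> maps the finite set of representatives injectively
  into itself, hence onto itself.\<close>

lemma S_mult_cancel:
  assumes "\<not> p dvd k" and "\<And>r. S r \<Longrightarrow> S (k * r)" and "S (k * r)"
  shows "S r"
proof -
  define T where "T = {r \<in> {0..<p}. S r}"
  define f where "f u = k * u mod p" for u
  have inj_eq: "p dvd u - v" if "f u = f v" for u v
  proof -
    have "p dvd k * (u - v)"
      using that by (simp add: f_def mod_eq_dvd_iff right_diff_distrib)
    then show ?thesis using assms(1) dvd_mult_iff by blast
  qed
  have S_mod: "S (u mod p)" if "S u" for u
    using S_cong[OF _ that] dvd_mod_diff[of u] dvd_diff_commute by blast
  have "f ` T \<subseteq> T"
    using p_gt_5 assms(2) S_mod by (auto simp: T_def f_def)
  moreover have "inj_on f T"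
  proof (rule inj_onI)
    fix u v assume "u \<in> T" "v \<in> T" "f u = f v"
    then have "u mod p = v mod p"
      using inj_eq mod_eq_dvd_iff by blast
    then show "u = v"
      using \<open>u \<in> T\<close> \<open>v \<in> T\<close> by (simp add: T_def)
  qed
  moreover have "finite T"
    unfolding T_def by (rule finite_subset[of _ "{0..<p}"]) auto
  ultimately have "f ` T = T"
    using endo_inj_surj by blast
  moreover have "f r \<in> T"
    using p_gt_5 S_mod[OF assms(3)] by (simp add: T_def f_def)
  ultimately obtain u where "u \<in> T" "f u = f r"
    by (metis imageE)
  then show ?thesis
    using inj_eq S_cong by (auto simp: T_def)
qed

lemma not_S_split_1: "\<not> S r" if "res (2 * r - 1)" and "\<not> special (2 * r - 1)"
  using S_split[of r 1 "2 * r - 1"] that res_1 not_special_1 not_S_1 by auto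

lemma not_S_sixth: "\<not> S u" if u: "p dvd 6 * u - 1"
proof (rule not_S_split_1)
  have y: "p dvd 3 * (2 * u - 1) - (-2)"
    using u by (simp add: algebra_simps)
  have "\<not> res (3 * (2 * u - 1))"
    using res_cong[OF y] res_minus_iff[of 2] not_res_2 by simp
  moreover have "\<not> p dvd 2 * u - 1"
  proof
    assume "p dvd 2 * u - 1"
    with y have "p dvd 2"
      by (rule dvd_lin2[where s = 1 and t = "-3", rotated]) simp
    then show False using not_dvd_2 by blast
  qed
  ultimately show "res (2 * u - 1)"
    using res_3_mult_cancel by blast
  show "\<not> special (2 * u - 1)"
    by (rule not_special_if[OF y]) (use not_dvd_13 not_dvd_5 in simp_all)
qed

lemma not_S_quarter: "\<not> S u" if u: "p dvd 4 * u - 1"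
proof
  assume "S u"
  have "\<not> p dvd 6"
    using not_dvd_res res_6 by blast
  then obtain t where t: "p dvd 6 * t - 1"
    by (rule inverse_exists)
  have "res t"
    using res_mult_cancel[OF res_6] res_cong[OF t] res_1 by blast
  \<comment> \<open>With \<open>u\<close> = 1/4 and \<open>t\<close> = 1/6, the sum
    \<open>2 * u + t\<close> is 2/3 = 4/6, a quotient of residues.\<close>
  have y: "p dvd 6 * (2 * u + t) - 4"
    using u t by (rule dvd_lin2[where s = 3 and t = 1, rotated]) simp
  have "res (2 * u + t)"
    using res_mult_cancel[OF res_6] res_cong[OF y] res_4 by blast
  moreover have "\<not> special (2 * u + t)"
    by (rule not_special_if[OF y])
      (use not_dvd_2 not_dvd_5 not_dvd_13 dvd_mult_iff[of 2 5] dvd_mult_iff[of 2 13] in simp_all)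
  moreover have "\<not> special t"
    by (rule not_special_if[OF t])
      (use not_dvd_2 not_dvd_5 dvd_mult_iff[of 2 2] dvd_mult_iff[of 2 5]
        dvd_mult_iff[of 4 4] dvd_mult_iff[of 4 5] in simp_all)
  ultimately have "S (- t)"
    using S_split[of u "- t" "2 * u + t"] \<open>S u\<close> \<open>res t\<close> by simp
  then show False
    using S_minus not_S_sixth[OF t] by fastforce
qed

lemma not_S_three_eighths: "\<not> S u" if u: "p dvd 8 * u - 3"
proof (rule not_S_split_1)
  have y: "p dvd 4 * (2 * u - 1) - (-1)"
    using u by (simp add: algebra_simps)
  show "res (2 * u - 1)"
    using res_mult_cancel[OF res_4] res_cong[OF y] res_minus_iff[of 1] res_1 by blast
  show "\<not> special (2 * u - 1)"
    by (rule not_special_if[OF y])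
      (use not_dvd_2 not_dvd_5 not_dvd_7 dvd_mult_iff[of 2 5] dvd_mult_iff[of 2 7] in simp_all)
qed

text \<open>The multiples \<open>4 * r\<close> and \<open>6 * r\<close> are special only for
  \<open>r\<close> equal to 3/8 or 1/4 up to sign, which are excluded; then
  \<open>2 * r = 6 * r - 4 * r\<close> splits.\<close>

lemma S_mult_4_6: assumes "S r" shows "S (4 * r)" and "S (6 * r)"
proof -
  have "\<not> special (4 * r)"
  proof -
    have "S (- r)" using assms by (rule S_minus)
    then have "\<not> p dvd 8 * r - 3" "\<not> p dvd 8 * - r - 3"
      using assms not_S_three_eighths by blast+
    then show ?thesis
      using dvd_minus_iff[of p "8 * - r - 3"] by (simp add: special_def add.commute)
  qed
  moreover have "\<not> special (6 * r)"
  proof -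
    have "S (- r)" using assms by (rule S_minus)
    then have "\<not> p dvd 4 * r - 1" "\<not> p dvd 4 * - r - 1"
      using assms not_S_quarter by blast+
    then have "\<not> p dvd 3 * (4 * r - 1)" "\<not> p dvd 3 * (4 * r + 1)"
      using not_dvd_3 dvd_minus_iff[of p "4 * - r - 1"]
      unfolding dvd_mult_iff by (simp_all add: add.commute)
    then show ?thesis
      by (simp add: special_def algebra_simps)
  qed
  moreover have "res (4 * r)" "res (6 * r)"
    using assms S_res res_mult res_4 res_6 by blast+
  ultimately show "S (6 * r)" "S (4 * r)"
    using S_split[OF assms, of "6 * r" "- (4 * r)"] S_split[OF assms, of "- (4 * r)" "6 * r"]
      S_minus[of "- (4 * r)"] by simp_all
qed

lemma not_S_inverse:
  assumes "res k" and "res (2 - k)" and l: "p dvd k * l - 1"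
  shows "\<not> S l"
proof
  assume "S l"
  have "p dvd k * (2 * l - 1) - (2 - k)"
    using l by (rule dvd_lin1[where s = 2, rotated]) (simp add: algebra_simps)
  then have "res (2 * l - 1)"
    using res_mult_cancel[OF assms(1)] res_cong assms(2) by blast
  then have "special (2 * l - 1)"
    using not_S_split_1 \<open>S l\<close> by blast
  \<comment> \<open>The cases are \<open>l\<close> = 5/4 and \<open>l\<close> = -1/4. The first
    gives \<open>S 5\<close>, refuted by 10 = 1 + 9.\<close>
  then consider "p dvd 4 * l - 5" | "p dvd 4 * l + 1"
    by (auto simp: special_def algebra_simps)
  then show False
  proof cases
    case 1
    then have "S 5"
      using S_cong S_mult_4_6(1) \<open>S l\<close> by blast
    then show False
      using not_S_split_1[of 5] res_9 not_special_9 by simp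
  next
    case 2
    then have "p dvd 4 * - l - 1"
      by (rule dvd_lin1[where s = "-1", rotated]) simp
    then show False
      using not_S_quarter S_minus \<open>S l\<close> by blast
  qed
qed

lemma not_special_mult:
  assumes "res k" and "res (2 - k)" and "S r"
  shows "\<not> special (r * k)"
proof
  assume "special (r * k)"
  obtain l where l: "p dvd k * l - 1"
    using inverse_exists not_dvd_res[OF assms(1)] by blast
  have *: "\<not> p dvd 2 * (r * k) - 3" if "S r" for r
  proof
    assume "p dvd 2 * (r * k) - 3"
    \<comment> \<open>Multiplying \<open>r * k\<close> = 3/2 by \<open>4 * l\<close>, with
      \<open>l\<close> inverse to \<open>k\<close>, gives \<open>4 * r\<close> =
      \<open>6 * l\<close>; the factor 6 can then be cancelled inside \<open>S\<close>.\<close>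
    then have "p dvd 4 * r - 6 * l"
      using l by (rule dvd_lin2[where s = "2 * l" and t = "- 4 * r", rotated])
        (simp add: algebra_simps)
    then have "S (6 * l)"
      using S_cong S_mult_4_6(1) that by blast
    then have "S l"
      using S_mult_cancel[of 6 l] S_mult_4_6(2) res_6 not_dvd_res by blast
    then show False
      using not_S_inverse assms(1,2) l by blast
  qed
  from \<open>special (r * k)\<close> consider "p dvd 2 * (r * k) - 3" | "p dvd 2 * (r * k) + 3"
    by (auto simp: special_def)
  then show False
  proof cases
    case 2
    then have "p dvd 2 * (- r * k) - 3"
      by (rule dvd_lin1[where s = "-1", rotated]) simp
    then show False using * S_minus assms(3) by blast
  qed (use * assms(3) in blast)
qed

lemma S_mult:
  assumes "res k" and "res (2 - k)" and "S r"
  shows "S (k * r)"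
proof -
  have "\<not> special (k * r)" "\<not> special ((2 - k) * r)"
    using not_special_mult[of k r] not_special_mult[of "2 - k" r] assms
    by (simp_all add: mult.commute)
  moreover have "res (k * r)" "res ((2 - k) * r)"
    using assms res_mult S_res by blast+
  ultimately show ?thesis
    using S_split[OF assms(3), of "k * r" "(2 - k) * r"] by (simp add: algebra_simps)
qed

text \<open>Every residue \<open>x\<close> either satisfies that \<open>2 - x\<close> is a residue, or else \<open>4/x\<close> does, because
  \<open>2 - 4/x = -2(2 - x)/x\<close> and 2 is a non-residue. Apply this to \<open>x = 4r\<close>.\<close>

lemma not_S: "\<not> S r"
proof
  assume "S r"
  have "res r" "S (4 * r)" "res (4 * r)"
    using \<open>S r\<close> S_res S_mult_4_6(1) by blast+
  \<comment> \<open>Otherwise multiplication by \<open>k\<close> preserves \<open>S\<close>, and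
    cancelling it from \<open>k\<close> = \<open>k * 1\<close> gives \<open>S 1\<close>.\<close>
  have *: "\<not> res (2 - k)" if "S k" for k
  proof
    assume "res (2 - k)"
    then have "S 1"
      using S_mult_cancel[of k 1] S_mult[of k] that S_res not_dvd_res by simp
    then show False using not_S_1 by blast
  qed
  have "\<not> res (2 - 4 * r)"
    using * \<open>S (4 * r)\<close> by blast
  moreover have "\<not> p dvd 2 - 4 * r"
    using res_cong[of 2 "4 * r"] \<open>res (4 * r)\<close> not_res_2 by blast
  moreover have "2 - 4 * r = 2 * (1 - 2 * r)"
    by simp
  ultimately have "res (1 - 2 * r)"
    using res_double_iff by (metis dvd_mult)
  then have "res (2 * r - 1)"
    using res_minus_iff[of "1 - 2 * r"] by simp
  obtain l where l: "p dvd r * l - 1"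
    using inverse_exists not_dvd_res[OF \<open>res r\<close>] by blast
  have "res l"
    using res_mult_cancel[OF \<open>res r\<close>] res_cong[OF l] res_1 by blast
  have "p dvd r * (2 - l) - (2 * r - 1)"
    using l by (rule dvd_lin1[where s = "-1", rotated]) (simp add: algebra_simps)
  then have "res (2 - l)"
    using res_mult_cancel[OF \<open>res r\<close>] res_cong \<open>res (2 * r - 1)\<close> by blast
  then have "S (l * r)"
    using S_mult \<open>res l\<close> \<open>S r\<close> by blast
  then have "S 1"
    using S_cong l by (simp add: mult.commute)
  then show False using not_S_1 by blast
qed

end

text \<open>A maximum principle: the maximum ranges over non-special residues only, since
  \<open>convex\<close> is available just there, and its level set satisfies the closure properties
  that force emptiness.\<close>

lemma no_convex_weight:
  fixes W :: "int \<Rightarrow> real"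
  assumes W_cong: "\<And>r s. p dvd r - s \<Longrightarrow> W r = W s"
    and W_minus: "\<And>r. W (- r) = W r"
    and convex: "\<And>r x y. res r \<Longrightarrow> res x \<Longrightarrow> res y \<Longrightarrow> \<not> special r \<Longrightarrow> p dvd x + y - 2 * r \<Longrightarrow>
      2 * W r \<le> W x + W y"
    and pos: "0 < W 1" and four: "2 * W 1 \<le> W 4"
  shows False
proof -
  define T where "T = {r \<in> {0..<p}. res r \<and> \<not> special r}"
  define M where "M = Max (W ` T)"
  define S where "S r \<longleftrightarrow> res r \<and> \<not> special r \<and> W r = M" for r
  have "finite T"
    unfolding T_def by (rule finite_subset[of _ "{0..<p}"]) auto
  have "1 \<in> T"
    using p_gt_5 res_1 not_special_1 by (simp add: T_def)
  have W_le: "W r \<le> M" if "res r" "\<not> special r" for r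
  proof -
    have "r mod p \<in> T"
      using that p_gt_5 res_cong[OF dvd_mod_diff] special_cong[OF dvd_mod_diff]
      by (simp add: T_def)
    then have "W (r mod p) \<le> M"
      using \<open>finite T\<close> by (simp add: M_def)
    then show ?thesis
      using W_cong[OF dvd_mod_diff] by simp
  qed
  have "\<not> S r" for r
  proof (rule not_S)
    show "S s" if "p dvd r - s" "S r" for r s
      using that res_cong special_cong W_cong by (metis S_def)
    show "S (- r)" if "S r" for r
      using that W_minus by (simp add: S_def)
    \<comment> \<open>The maximum is at least \<open>W 4\<close>, hence at least
      \<open>2 * W 1\<close>, which exceeds \<open>W 1\<close>.\<close>
    show "\<not> S 1"
      using W_le[OF res_4 not_special_4] four pos by (auto simp: S_def)
    \<comment> \<open>Two values bounded by \<open>M\<close> whose mean is at least \<open>M\<close>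
      both equal \<open>M\<close>.\<close>
    show "S x" if "S r" "res x" "res y" "\<not> special x" "\<not> special y" "p dvd x + y - 2 * r"
      for r x y
      using convex[of r x y] W_le[of x] W_le[of y] that by (simp add: S_def)
  qed (simp add: S_def)
  moreover have "M \<in> W ` T"
    unfolding M_def using \<open>finite T\<close> \<open>1 \<in> T\<close> by (intro Max_in) auto
  ultimately show False
    by (auto simp: S_def T_def)
qed

section \<open>Averaging a metrizing weight over translations\<close>

lemma sum_shift: "(\<Sum>a\<in>paley_V p. f ((a + s) mod p)) = (\<Sum>a\<in>paley_V p. f a)"
proof (rule sum.reindex_bij_betw)
  show "bij_betw (\<lambda>a. (a + s) mod p) (paley_V p) (paley_V p)"
    by (rule bij_betw_byWitness[where f' = "\<lambda>a. (a - s) mod p"])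
      (auto simp: mod_in_V mod_V mod_diff_left_eq mod_add_left_eq)
qed

definition total_weight :: "(int set \<Rightarrow> real) \<Rightarrow> int \<Rightarrow> real"
  where "total_weight w r = (\<Sum>a\<in>paley_V p. w {a, (a + r) mod p})"

lemma sum_weight_shift:
  "(\<Sum>a\<in>paley_V p. w {(a + s) mod p, (a + t) mod p}) = total_weight w (t - s)"
proof -
  have "(a + t) mod p = ((a + s) mod p + (t - s)) mod p" for a
    by (simp add: mod_add_left_eq)
  then show ?thesis
    using sum_shift[of "\<lambda>a. w {a, (a + (t - s)) mod p}" s] by (simp add: total_weight_def)
qed

lemma total_weight_cong: "p dvd r - s \<Longrightarrow> total_weight w r = total_weight w s"
proof -
  assume "p dvd r - s"
  then have "(a + r) mod p = (a + s) mod p" for a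
    by (simp add: mod_eq_dvd_iff)
  then show ?thesis by (simp add: total_weight_def)
qed

lemma total_weight_minus: "total_weight w (- r) = total_weight w r"
proof -
  have "total_weight w (- r) = (\<Sum>a\<in>paley_V p. w {(a + r) mod p, (a + 0) mod p})"
    using sum_weight_shift[of w r 0] by simp
  also have "\<dots> = total_weight w r"
    unfolding total_weight_def
    by (rule sum.cong) (simp_all add: mod_V insert_commute[of _ "_ mod p"])
  finally show ?thesis .
qed

lemma paley_not_metrizable: "\<not> metrizable (paley_adj p) (paley_V p) (paley_P p)"
proof
  let ?V = "paley_V p" and ?path = "is_path (paley_adj p) (paley_V p)"
  assume "metrizable (paley_adj p) ?V (paley_P p)"
  then obtain w where pos: "\<And>a b. a \<in> ?V \<Longrightarrow> b \<in> ?V \<Longrightarrow> paley_adj p a b \<Longrightarrow> w {a, b} > 0"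
    and le: "\<And>u v Q. u \<in> ?V \<Longrightarrow> v \<in> ?V \<Longrightarrow> u \<noteq> v \<Longrightarrow> ?path Q u v \<Longrightarrow>
      path_weight w (paley_P p u v) \<le> path_weight w Q"
    unfolding metrizable_def by blast
  let ?W = "total_weight w"
  have edge: "(\<Sum>a\<in>?V. w {a, (a + t) mod p}) = ?W t" for t
    by (simp add: total_weight_def)
  have le_mod: "path_weight w (paley_P p a ((a + d) mod p)) \<le>
      w {a, (a + x) mod p} + w {(a + x) mod p, (a + d) mod p}"
    if "a \<in> ?V" "res x" "res y" "d = x + y" "\<not> p dvd d" for a d x y
    using le[OF _ _ _ is_path_mod2[of a x y]] that mod_in_V mod_neq[of "a + d" a]
    by (auto simp: path_weight_Cons mod_V)
  show False
  proof (rule no_convex_weight)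
    show "?W r = ?W s" if "p dvd r - s" for r s
      using that by (rule total_weight_cong)
    show "?W (- r) = ?W r" for r
      by (rule total_weight_minus)
    have "paley_adj p a ((a + 1) mod p)" if "a \<in> ?V" for a
      using adj_mod[of a "a + 1"] mod_V[OF that] res_1 by simp
    then show "0 < ?W 1"
      unfolding total_weight_def using p_gt_5
      by (intro sum_pos pos mod_in_V) (auto simp: paley_V_def)
    \<comment> \<open>Summed over \<open>a\<close>, the detour through \<open>a + 4\<close> gives
      \<open>3 * ?W 1 \<le> ?W 4 + ?W (-1)\<close>; evenness cancels one term.\<close>
    have "(\<Sum>a\<in>?V. w {a, (a + 1) mod p} + (w {(a + 1) mod p, (a + 2) mod p}
        + w {(a + 2) mod p, (a + 3) mod p}))
      \<le> (\<Sum>a\<in>?V. w {a, (a + 4) mod p} + w {(a + 4) mod p, (a + 3) mod p})"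
    proof (rule sum_mono)
      fix a assume a: "a \<in> ?V"
      show "w {a, (a + 1) mod p} + (w {(a + 1) mod p, (a + 2) mod p}
          + w {(a + 2) mod p, (a + 3) mod p})
        \<le> w {a, (a + 4) mod p} + w {(a + 4) mod p, (a + 3) mod p}"
        using le_mod[OF a res_4, of "-1" 3] not_dvd_3 res_1 paley_P_three(1)[OF a]
        by (simp add: path_weight_Cons)
    qed
    then show "2 * ?W 1 \<le> ?W 4"
      using total_weight_minus[of w 1]
      by (simp add: sum.distrib sum_weight_shift edge)
    show "2 * ?W r \<le> ?W x + ?W y"
      if "res r" "res x" "res y" "\<not> special r" "p dvd x + y - 2 * r" for r x y
    proof -
      \<comment> \<open>\<open>y\<close> is known only modulo \<open>p\<close>; its replacement
        \<open>z\<close> makes \<open>x + z = 2 * r\<close> hold exactly, as \<open>le_mod\<close>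
        expects.\<close>
      define z where "z = 2 * r - x"
      have z: "p dvd y - z"
        using that by (simp add: z_def algebra_simps)
      then have "res z"
        using res_cong that(3) by blast
      have "\<not> p dvd 2 * r"
        using not_dvd_res[OF that(1)] not_dvd_2 dvd_mult_iff by blast
      have "(\<Sum>a\<in>?V. w {a, (a + r) mod p} + w {(a + r) mod p, (a + 2 * r) mod p})
        \<le> (\<Sum>a\<in>?V. w {a, (a + x) mod p} + w {(a + x) mod p, (a + 2 * r) mod p})"
      proof (rule sum_mono)
        fix a assume a: "a \<in> ?V"
        show "w {a, (a + r) mod p} + w {(a + r) mod p, (a + 2 * r) mod p}
          \<le> w {a, (a + x) mod p} + w {(a + x) mod p, (a + 2 * r) mod p}"
          using le_mod[OF a that(2) \<open>res z\<close>, of "2 * r"] \<open>\<not> p dvd 2 * r\<close>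
            paley_P_mid[OF a that(1)] that(4)
          by (simp add: path_weight_Cons z_def special_def)
      qed
      then show ?thesis
        using total_weight_cong[OF z, of w]
        by (simp add: sum.distrib sum_weight_shift edge z_def)
    qed
  qed
qed

end

theorem theorem1:
  fixes p :: int
  assumes "prime p" and "p > 5"
    and "QuadRes p (-1)" and "\<not> QuadRes p 2" and "\<not> QuadRes p 3"
  shows "path_system (paley_adj p) (paley_V p) (paley_P p) \<and>
         irreducible_ps (paley_V p) (paley_P p) \<and>
         \<not> metrizable (paley_adj p) (paley_V p) (paley_P p)"
proof -
  interpret paley_prime p
    using assms by unfold_locales
  show ?thesis
    using paley_path_system paley_irreducible paley_not_metrizable by blast
qed

end
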